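(* Let $S$ be a $*$-monoid and let $a,b,c\in S$ satisfy $(ab)^{*}=ab$ and $(ac)^{*}=ac$. Then the following hold. (I) The following conditions are equivalent: (1) $a$ is both left $(b,c)$-invertible and left $(c,b)$-invertible; (2) $a$ is both $(b,c)$-invertible and $(c,b)$-invertible. In this case, $a^{||(b,c)}=xc$ and $a^{||(c,b)}=yb$, where $x,y\in S$ are such that $b=xcab$ and $c=ybac$. (II) The following conditions are equivalent: (1) $a$ is both right $(b,c)$-invertible and right $(c,b)$-invertible; (2) $a$ is both $(b,c)$-invertible and $(c,b)$-invertible. In this case, $a^{||(b,c)}=by$ and $a^{||(c,b)}=cx$, where $x,y\in S$ are such that $b=bacx$ and $c=caby$.
   Context: A $*$-monoid is a monoid $S$ with an involution, i.e. a map $*:S\to S$ with $(a^{*})^{*}=a$ and $(ab)^{*}=b^{*}a^{*}$ for all $a,b\in S$. For $a,b,c\in S$: $a$ is $(b,c)$-invertible if there exists $y\in S$ with $y\in bSy\cap ySc$, $yab=b$, $cay=c$; such a $y$ is unique if it exists and is denoted $a^{||(b,c)}$ (the $(b,c)$-inverse of $a$). $a$ is left $(b,c)$-invertible if $b\in Scab$ (equivalently, there is $x\in Sc$ with $xab=b$). $a$ is right $(b,c)$-invertible if $c\in cabS$ (equivalently, there is $z\in bS$ with $caz=c$). The notions with $(c,b)$ are obtained by interchanging $b$ and $c$. *)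

theory Defs
  imports Main
begin

class star_monoid = monoid_mult +
  fixes star :: "'a \<Rightarrow> 'a"
  assumes star_star: "star (star a) = a"
    and star_mult: "star (a * b) = star b * star a"

definition is_bc_inverse :: "'a::monoid_mult \<Rightarrow> 'a \<Rightarrow> 'a \<Rightarrow> 'a \<Rightarrow> bool" where
  "is_bc_inverse a b c y \<longleftrightarrow>
     y \<in> {b * s * y | s. True} \<inter> {y * s * c | s. True} \<and> y * a * b = b \<and> c * a * y = c"

definition bc_invertible :: "'a::monoid_mult \<Rightarrow> 'a \<Rightarrow> 'a \<Rightarrow> bool" where
  "bc_invertible a b c \<longleftrightarrow> (\<exists>y. is_bc_inverse a b c y)"

lemma is_bc_inverse_unique:
  assumes "is_bc_inverse a b c y" and "is_bc_inverse a b c z"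
  shows "y = z"
proof -
  obtain s where s: "y = y * s * c"
    using assms(1) unfolding is_bc_inverse_def by blast
  obtain t where t: "z = b * t * z"
    using assms(2) unfolding is_bc_inverse_def by blast
  have "y = y * s * (c * a * z)"
    using s assms(2) unfolding is_bc_inverse_def by simp
  also have "\<dots> = (y * s * c) * a * z"
    by (simp only: mult.assoc)
  also have "\<dots> = y * a * z"
    using s by simp
  also have "\<dots> = y * a * (b * t * z)"
    using t by simp
  also have "\<dots> = (y * a * b) * t * z"
    by (simp only: mult.assoc)
  also have "\<dots> = z"
    using t assms(1) unfolding is_bc_inverse_def by simp
  finally show ?thesis .
qed

text \<open>Meaningful only when \<^term>\<open>bc_invertible a b c\<close> holds; the value is then the
  unique inverse by is_bc_inverse_unique.\<close>

definition bc_inverse :: "'a::monoid_mult \<Rightarrow> 'a \<Rightarrow> 'a \<Rightarrow> 'a" where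
  "bc_inverse a b c = (THE y. is_bc_inverse a b c y)"

lemma bc_inverse_eqI: "is_bc_inverse a b c y \<Longrightarrow> bc_inverse a b c = y"
  unfolding bc_inverse_def by (blast intro: is_bc_inverse_unique)

definition left_bc_invertible :: "'a::monoid_mult \<Rightarrow> 'a \<Rightarrow> 'a \<Rightarrow> bool" where
  "left_bc_invertible a b c \<longleftrightarrow> b \<in> {s * c * a * b | s. True}"

definition right_bc_invertible :: "'a::monoid_mult \<Rightarrow> 'a \<Rightarrow> 'a \<Rightarrow> bool" where
  "right_bc_invertible a b c \<longleftrightarrow> c \<in> {c * a * b * s | s. True}"

end

theory Submission
  imports Defs
begin

text \<open>An element \<open>a\<close> is \<open>(b,c)\<close>-invertible precisely when it is left and right
  \<open>(b,c)\<close>-invertible, and then \<open>xc = bz\<close> is the inverse whenever \<open>b = xcab\<close> and \<open>c = cabz\<close>.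
  Since \<open>p = ab\<close> and \<open>q = ac\<close> are self-adjoint, applying the involution to the equations they
  inherit from the one-sided invertibility of \<open>a\<close> turns left factors into right ones, so the
  two left conditions together imply the two right ones, and conversely.\<close>

lemma is_bc_inverse_if_left_right:
  fixes a b c :: "'a::monoid_mult"
  assumes l: "b = x * c * a * b" and r: "c = c * a * b * z"
  shows "is_bc_inverse a b c (x * c)" and "is_bc_inverse a b c (b * z)"
proof -
  \<comment> \<open>Bracketing \<open>x * c * a * b * z\<close> in two ways gives
    \<open>x * c\<close> by \<open>r\<close> and \<open>b * z\<close> by \<open>l\<close>.\<close>
  have "x * c = x * c * a * b * z"
    using r by (metis mult.assoc)
  then have eq: "x * c = b * z"
    using l by simp
  \<comment> \<open>With \<open>y = x * c = b * z\<close>, both factorizations are readings of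
    \<open>y = y * a * y\<close>.\<close>
  have "x * c = b * (z * a) * (x * c)"
    using l eq by (metis mult.assoc)
  moreover have "x * c = (x * c) * (a * x) * c"
    using l eq by (metis mult.assoc)
  moreover have "c * a * (x * c) = c"
    using r eq by (metis mult.assoc)
  ultimately show "is_bc_inverse a b c (x * c)"
    unfolding is_bc_inverse_def using l[symmetric] by blast
  then show "is_bc_inverse a b c (b * z)"
    using eq by simp
qed

lemma bc_invertible_iff_left_right:
  "bc_invertible a b c \<longleftrightarrow> left_bc_invertible a b c \<and> right_bc_invertible a b c"
proof
  assume "bc_invertible a b c"
  then obtain y s t where "y = b * s * y" "y = y * t * c" "y * a * b = b" "c * a * y = c"
    unfolding bc_invertible_def is_bc_inverse_def by blast
  then have "b = (y * t) * c * a * b" "c = c * a * b * (s * y)"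
    by (metis mult.assoc)+
  then show "left_bc_invertible a b c \<and> right_bc_invertible a b c"
    unfolding left_bc_invertible_def right_bc_invertible_def by blast
next
  assume "left_bc_invertible a b c \<and> right_bc_invertible a b c"
  then show "bc_invertible a b c"
    unfolding left_bc_invertible_def right_bc_invertible_def bc_invertible_def
    by (blast intro: is_bc_inverse_if_left_right)
qed

text \<open>Write p, q for \<open>a * b\<close>, \<open>a * c\<close>. Substituting one left
  equation into the other gives b = w b q p, hence p = (a w b) q p. The involution reverses this to
  p = p q (a w b)*, which puts b q on the left of a product equal to b.\<close>

lemma right_bc_invertible_if_left:
  fixes a b c :: "'a::star_monoid"
  assumes p: "star (a * b) = a * b" and q: "star (a * c) = a * c"
    and "left_bc_invertible a b c" and "left_bc_invertible a c b"
  shows "right_bc_invertible a c b"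
proof -
  obtain x y where x: "b = x * c * a * b" and y: "c = y * b * a * c"
    using assms(3,4) unfolding left_bc_invertible_def by blast
  define w where "w = x * y"
  have b: "b = w * b * (a * c) * (a * b)"
    unfolding w_def using x y by (metis mult.assoc)
  then have "a * b = (a * w * b) * ((a * c) * (a * b))"
    by (metis mult.assoc)
  then have "star (a * b) = star ((a * w * b) * ((a * c) * (a * b)))"
    by simp
  then have ab: "a * b = (a * b) * (a * c) * star (a * w * b)"
    unfolding star_mult[of "a * w * b"] star_mult[of "a * c"] p q .
  \<comment> \<open>Only the last factor \<open>a * b\<close> of equation \<open>b\<close> is
    replaced, so that \<open>w * b * (a * c) * (a * b)\<close> reappears and collapses to
    \<open>b\<close>.\<close>
  have "b = w * b * (a * c) * ((a * b) * (a * c) * star (a * w * b))"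
    using b ab by simp
  also have "\<dots> = (w * b * (a * c) * (a * b)) * (a * c) * star (a * w * b)"
    by (simp only: mult.assoc)
  also have "\<dots> = b * a * c * star (a * w * b)"
    unfolding b[symmetric] by (simp only: mult.assoc)
  finally show ?thesis
    unfolding right_bc_invertible_def by blast
qed

text \<open>Not the mirror image of the preceding lemma: reversing products would call for
  self-adjoint \<open>b * a\<close> and \<open>c * a\<close>. With p, q as there, b = b q x is
  expanded by q = y* p q, then p q x = p and p = x* q p bring q p to the right end.\<close>

lemma left_bc_invertible_if_right:
  fixes a b c :: "'a::star_monoid"
  assumes p: "star (a * b) = a * b" and q: "star (a * c) = a * c"
    and "right_bc_invertible a b c" and "right_bc_invertible a c b"
  shows "left_bc_invertible a b c"
proof -
  obtain x y where x: "b = b * a * c * x" and y: "c = c * a * b * y"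
    using assms(3,4) unfolding right_bc_invertible_def by blast
  have px: "a * b = (a * b) * ((a * c) * x)" and qy: "a * c = (a * c) * ((a * b) * y)"
    using x y by (metis mult.assoc)+
  have p': "a * b = star x * (a * c) * (a * b)"
    using arg_cong[OF px, of star] unfolding star_mult[of "a * b"] star_mult[of "a * c"] p q .
  have q': "a * c = star y * (a * b) * (a * c)"
    using arg_cong[OF qy, of star] unfolding star_mult[of "a * c"] star_mult[of "a * b"] p q .
  have "b = b * (a * c) * x"
    using x by (simp only: mult.assoc)
  also have "\<dots> = b * (star y * (a * b) * (a * c)) * x"
    using q' by simp
  also have "\<dots> = b * star y * ((a * b) * ((a * c) * x))"
    by (simp only: mult.assoc)
  also have "\<dots> = b * star y * (star x * (a * c) * (a * b))"
    unfolding px[symmetric] using p' by simp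
  also have "\<dots> = (b * star y * star x * a) * c * a * b"
    by (simp only: mult.assoc)
  finally show ?thesis
    unfolding left_bc_invertible_def by blast
qed

theorem theorem3p6:
  fixes a b c :: "'a::star_monoid"
  assumes "star (a * b) = a * b" and "star (a * c) = a * c"
  shows
    "((left_bc_invertible a b c \<and> left_bc_invertible a c b \<longleftrightarrow>
         bc_invertible a b c \<and> bc_invertible a c b) \<and>
      (bc_invertible a b c \<and> bc_invertible a c b \<longrightarrow>
         (\<forall>x y. b = x * c * a * b \<and> c = y * b * a * c \<longrightarrow>
            bc_inverse a b c = x * c \<and> bc_inverse a c b = y * b))) \<and>
     ((right_bc_invertible a b c \<and> right_bc_invertible a c b \<longleftrightarrow>
         bc_invertible a b c \<and> bc_invertible a c b) \<and>
      (bc_invertible a b c \<and> bc_invertible a c b \<longrightarrow>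
         (\<forall>x y. b = b * a * c * x \<and> c = c * a * b * y \<longrightarrow>
            bc_inverse a b c = b * y \<and> bc_inverse a c b = c * x)))"
proof -
  \<comment> \<open>The hypotheses are symmetric in \<open>b\<close> and \<open>c\<close>, so each
    transfer lemma is used in both orders.\<close>
  note pq = assms and qp = assms(2,1)
  have left: "left_bc_invertible a b c \<and> left_bc_invertible a c b \<longleftrightarrow>
      bc_invertible a b c \<and> bc_invertible a c b"
    using right_bc_invertible_if_left[OF pq] right_bc_invertible_if_left[OF qp]
    by (auto simp: bc_invertible_iff_left_right)
  have right: "right_bc_invertible a b c \<and> right_bc_invertible a c b \<longleftrightarrow>
      bc_invertible a b c \<and> bc_invertible a c b"
    using left_bc_invertible_if_right[OF pq] left_bc_invertible_if_right[OF qp]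
    by (auto simp: bc_invertible_iff_left_right)
  have inverses: "(\<forall>x y. b = x * c * a * b \<and> c = y * b * a * c \<longrightarrow>
        bc_inverse a b c = x * c \<and> bc_inverse a c b = y * b) \<and>
      (\<forall>x y. b = b * a * c * x \<and> c = c * a * b * y \<longrightarrow>
        bc_inverse a b c = b * y \<and> bc_inverse a c b = c * x)"
    if inv: "bc_invertible a b c \<and> bc_invertible a c b"
  proof -
    \<comment> \<open>Given \<open>x\<close>, \<open>y\<close> solve equations on one side only;
      \<open>l\<close> and \<open>r\<close> supply the other side, and uniqueness makes the result
      independent of the choice.\<close>
    obtain u v where l: "b = u * c * a * b" "c = v * b * a * c"
      using inv unfolding left[symmetric] left_bc_invertible_def by blast
    obtain s t where r: "b = b * a * c * s" "c = c * a * b * t"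
      using inv unfolding right[symmetric] right_bc_invertible_def by blast
    show ?thesis
    proof (intro conjI allI impI; elim conjE)
      fix x y
      assume "b = x * c * a * b" "c = y * b * a * c"
      then show "bc_inverse a b c = x * c" and "bc_inverse a c b = y * b"
        using r by (metis is_bc_inverse_if_left_right(1) bc_inverse_eqI)+
    next
      fix x y
      assume "b = b * a * c * x" "c = c * a * b * y"
      then show "bc_inverse a b c = b * y" and "bc_inverse a c b = c * x"
        using l by (metis is_bc_inverse_if_left_right(2) bc_inverse_eqI)+
    qed
  qed
  show ?thesis
    using left right inverses by blast
qed

end
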